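(* Let $\varphi_{Ne}(z)=1+z-z^3/3$ for $z\in\mathbb{D}$. If $\beta\ge 1/2$ and $p$ is analytic in $\mathbb{D}$ with $p(0)=1$ and $$p(z)+\beta zp'(z)\prec 1+z,$$ then $p\prec\varphi_{Ne}$. Moreover, this estimate on $\beta$ is sharp: for every $\beta$ with $0<\beta<1/2$ there is an analytic $p$ on $\mathbb{D}$ with $p(0)=1$ and $p(z)+\beta zp'(z)\prec 1+z$ for which $p\prec\varphi_{Ne}$ fails.
   Context: $\mathbb{D}=\{z\in\mathbb{C}:|z|<1\}$. For $f$ analytic on $\mathbb{D}$ and $g$ univalent (analytic and injective) on $\mathbb{D}$, $f$ is subordinate to $g$, written $f\prec g$ (or $f(z)\prec g(z)$), if and only if $f(0)=g(0)$ and $f(\mathbb{D})\subset g(\mathbb{D})$. The function $\varphi_{Ne}(z)=1+z-z^3/3$ is univalent on $\mathbb{D}$. *)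

theory Defs
  imports "HOL-Complex_Analysis.Complex_Analysis"
begin

abbreviation unit_disc :: "complex set" where
  "unit_disc \<equiv> ball 0 1"

definition univalent :: "(complex \<Rightarrow> complex) \<Rightarrow> bool" where
  "univalent g \<longleftrightarrow> g holomorphic_on unit_disc \<and> inj_on g unit_disc"

text \<open>Subordination is meant for \<open>f\<close> holomorphic and \<open>g\<close> univalent on the unit disc.
  These conditions are not part of the predicate, so that its negation says exactly that
  \<open>f 0 \<noteq> g 0\<close> or that the inclusion of images fails; the two superordinate functions used,
  \<open>1 + z\<close> and \<open>phi_Ne\<close>, are shown to be univalent below.\<close>

definition subordinate :: "(complex \<Rightarrow> complex) \<Rightarrow> (complex \<Rightarrow> complex) \<Rightarrow> bool"
    (infix "\<prec>\<^sub>s" 50) where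
  "f \<prec>\<^sub>s g \<longleftrightarrow> f 0 = g 0 \<and> f ` unit_disc \<subseteq> g ` unit_disc"

definition phi_Ne :: "complex \<Rightarrow> complex" where
  "phi_Ne z = 1 + z - z ^ 3 / 3"

lemma univalent_add_one: "univalent (\<lambda>z. 1 + z)"
  unfolding univalent_def by (auto intro!: holomorphic_intros inj_onI)

lemma univalent_phi_Ne: "univalent phi_Ne"
  unfolding univalent_def
proof (intro conjI inj_onI)
  show "phi_Ne holomorphic_on unit_disc"
    unfolding phi_Ne_def by (intro holomorphic_intros) auto
next
  fix a b :: complex
  assume "a \<in> unit_disc" "b \<in> unit_disc" and eq: "phi_Ne a = phi_Ne b"
  then have a: "norm a < 1" and b: "norm b < 1" by auto
  have "norm (a\<^sup>2 + a * b + b\<^sup>2) \<le> norm (a\<^sup>2) + norm (a * b) + norm (b\<^sup>2)"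
    by (meson add_right_mono norm_triangle_ineq order_trans)
  also have "\<dots> = norm a * norm a + norm a * norm b + norm b * norm b"
    by (simp add: norm_mult power2_eq_square)
  also have "\<dots> < 3"
    using mult_strict_mono'[OF a a] mult_strict_mono'[OF a b] mult_strict_mono'[OF b b]
    by simp
  finally have "a\<^sup>2 + a * b + b\<^sup>2 \<noteq> 3" by auto
  moreover have "(a - b) * (3 - (a\<^sup>2 + a * b + b\<^sup>2)) = 3 * (phi_Ne a - phi_Ne b)"
    unfolding phi_Ne_def by (simp add: field_simps power2_eq_square power3_eq_cube)
  ultimately show "a = b" using eq by auto
qed

end

theory Submission
  imports Defs
begin

text \<open>
  Write \<open>p = 1 + P\<close>. The hypothesis says that \<open>P + \<beta> z P'\<close> maps the unit disc into itself and fixes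
  the origin, so by the Schwarz lemma it is bounded by \<open>\<bar>z\<bar>\<close>. The operator \<open>P \<mapsto> P + \<beta> z P'\<close>
  multiplies \<open>z\<^sup>n\<close> by \<open>1 + n \<beta>\<close>, and its inverse is the averaging operator
  \<open>Q \<mapsto> (1/\<beta>) \<integral> t powr (1/\<beta> - 1) Q(t z) dt\<close> over \<open>0 \<le> t \<le> 1\<close>; hence the bound \<open>\<bar>z\<bar>\<close> is improved to
  \<open>\<bar>P z\<bar> \<le> \<bar>z\<bar> / (1 + \<beta>)\<close> (lemma \<open>norm_le_if_norm_add_deriv_le\<close>), with equality for \<open>P = z / (1 + \<beta>)\<close>.
  The theorem therefore compares the disc about \<open>1\<close> of radius \<open>1 / (1 + \<beta>)\<close> with the image of
  \<open>phi_Ne\<close>. The largest disc about \<open>1\<close> inside that image has radius \<open>2/3\<close>: it is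
  contained in the image (lemma \<open>ball_subset_phi_Ne_image\<close>), whereas the cusp \<open>phi_Ne 1 = 5/3\<close> and all
  real points to its right are omitted (lemma \<open>notin_phi_Ne_image\<close>). Finally \<open>1 / (1 + \<beta>) \<le> 2/3\<close> holds
  exactly when \<open>\<beta> \<ge> 1/2\<close>.
\<close>

text \<open>With \<open>a = 1/\<beta>\<close>, the function \<open>t powr a * P(t z)\<close> has derivative \<open>a t powr (a - 1) * Q(t z)\<close> on
  \<open>(0, 1)\<close>, where \<open>Q = P + \<beta> z P'\<close>. By hypothesis this is bounded by \<open>a t powr a * \<bar>z\<bar>\<close>, which is the
  derivative of \<open>t powr (a + 1) * \<bar>z\<bar> / (1 + \<beta>)\<close>. The mean value inequality compares the increments
  of the two functions over \<open>[0, 1]\<close>; both tend to \<open>0\<close> at \<open>0\<close> because \<open>a > 0\<close>.\<close>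

lemma norm_le_if_norm_add_deriv_le:
  fixes P :: "complex \<Rightarrow> complex" and \<beta> :: real
  assumes "0 < \<beta>" and hol: "P holomorphic_on unit_disc"
    and bound: "\<And>w. w \<in> unit_disc \<Longrightarrow> norm (P w + of_real \<beta> * w * deriv P w) \<le> norm w"
    and z: "z \<in> unit_disc"
  shows "norm (P z) \<le> norm z / (1 + \<beta>)"
proof -
  define a where "a = 1 / \<beta>"
  have a: "a > 0" "a * \<beta> = 1" using \<open>0 < \<beta>\<close> by (auto simp: a_def)
  define f where "f t = (t powr a) *\<^sub>R P (of_real t * z)" for t :: real
  define Q where "Q w = P w + of_real \<beta> * w * deriv P w" for w
  define \<phi> where "\<phi> t = t powr (a + 1) * (norm z / (1 + \<beta>))" for t :: real
  have in_disc: "of_real t * z \<in> unit_disc" if "0 \<le> t" "t \<le> 1" for t :: real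
    using that z mult_left_le_one_le[of "norm z" t] by (auto simp: norm_mult)
  have "norm (f 1 - f 0) \<le> \<phi> 1 - \<phi> 0"
  proof (rule differentiable_bound_general)
    show "continuous_on {0..1} f"
      unfolding f_def using a in_disc
      by (intro continuous_intros continuous_on_powr'
          continuous_on_compose2[OF holomorphic_on_imp_continuous_on[OF hol]]) auto
    show "continuous_on {0..1} \<phi>"
      unfolding \<phi>_def using a by (intro continuous_intros continuous_on_powr') auto
  next
    fix t :: real
    assume t: "0 < t" "t < 1"
    have powr: "t powr a = t * t powr (a - 1)"
      using t by (simp add: powr_mult_base)
    have "a * t powr (a - 1) * (\<beta> * t) = (a * \<beta>) * (t * t powr (a - 1))"
      by (simp only: mult_ac)
    then have powr_beta: "t powr a = a * t powr (a - 1) * (\<beta> * t)"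
      using a powr by simp
    have dP: "(P has_field_derivative deriv P (of_real t * z)) (at (of_real t * z))"
      using holomorphic_derivI[OF hol _ in_disc] t by simp
    have "((\<lambda>t. P (of_real t * z)) has_vector_derivative z * deriv P (of_real t * z)) (at t)"
      by (rule field_vector_diff_chain_at[where f = "\<lambda>t. of_real t * z", unfolded o_def, OF _ dP])
         (auto intro!: derivative_eq_intros)
    moreover have "((\<lambda>t. t powr a) has_real_derivative a * t powr (a - 1)) (at t)"
      using t by (intro has_real_derivative_powr)
    ultimately have "(f has_vector_derivative
        t powr a *\<^sub>R (z * deriv P (of_real t * z))
        + (a * t powr (a - 1)) *\<^sub>R P (of_real t * z)) (at t)"
      unfolding f_def by (rule has_vector_derivative_scaleR[rotated])
    also have "t powr a *\<^sub>R (z * deriv P (of_real t * z))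
        + (a * t powr (a - 1)) *\<^sub>R P (of_real t * z)
        = (a * t powr (a - 1)) *\<^sub>R Q (of_real t * z)"
      unfolding powr_beta Q_def by (simp add: scaleR_conv_of_real algebra_simps)
    finally show "(f has_vector_derivative (a * t powr (a - 1)) *\<^sub>R Q (of_real t * z)) (at t)" .
    have a_plus_1: "a + 1 = a * (1 + \<beta>)"
      using a by (simp add: algebra_simps)
    have "(\<phi> has_real_derivative (a + 1) * t powr (a + 1 - 1) * (norm z / (1 + \<beta>))) (at t)"
      unfolding \<phi>_def using t by (intro DERIV_cmult_right has_real_derivative_powr)
    also have "(a + 1) * t powr (a + 1 - 1) * (norm z / (1 + \<beta>)) = a * t powr a * norm z"
      unfolding add_diff_cancel_right' unfolding a_plus_1 using \<open>0 < \<beta>\<close> by simp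
    finally show "(\<phi> has_vector_derivative a * t powr a * norm z) (at t)"
      by (simp add: has_real_derivative_iff_has_vector_derivative)
    have "norm (Q (of_real t * z)) \<le> t * norm z"
      using bound[OF in_disc, of t] t by (simp add: Q_def norm_mult)
    then have "(a * t powr (a - 1)) * norm (Q (of_real t * z)) \<le> (a * t powr (a - 1)) * (t * norm z)"
      using a by (intro mult_left_mono) auto
    then show "norm ((a * t powr (a - 1)) *\<^sub>R Q (of_real t * z)) \<le> a * t powr a * norm z"
      using a by (simp add: powr abs_mult mult_ac)
  qed simp
  then show ?thesis by (simp add: f_def \<phi>_def)
qed

text \<open>Solving \<open>phi_Ne z = w\<close> means finding a fixed point of \<open>z \<mapsto> (w - 1) + z\<^sup>3 / 3\<close>. On the closed
  unit disc this map has values of norm at most \<open>\<bar>w - 1\<bar> + 1/3 < 1\<close>, so Brouwer's theorem gives a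
  fixed point, and the fixed point lies in the open disc.\<close>

lemma ball_subset_phi_Ne_image: "ball 1 (2 / 3) \<subseteq> phi_Ne ` unit_disc"
proof
  fix w :: complex
  assume "w \<in> ball 1 (2 / 3)"
  then have w: "norm (w - 1) < 2 / 3" by (simp add: dist_norm norm_minus_commute)
  define T where "T z = (w - 1) + z ^ 3 / 3" for z :: complex
  have T: "norm (T z) < 1" if "norm z \<le> 1" for z
  proof -
    have "norm (T z) \<le> norm (w - 1) + norm (z ^ 3 / 3)"
      unfolding T_def by (rule norm_triangle_ineq)
    also have "norm (z ^ 3 / 3) \<le> 1 / 3"
      using power_le_one[OF norm_ge_zero that, of 3] by (simp add: norm_divide norm_power)
    finally show ?thesis using w by simp
  qed
  have "continuous_on (cball 0 1) T"
    unfolding T_def by (intro continuous_intros) auto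
  moreover have "T \<in> cball 0 1 \<rightarrow> cball 0 1"
    using T by (simp add: less_imp_le)
  ultimately obtain z where "z \<in> cball 0 1" "T z = z"
    using brouwer[of "cball 0 1" T] by auto
  then have "norm z < 1" and "w = phi_Ne z"
    using T[of z] by (auto simp: T_def phi_Ne_def algebra_simps)
  then show "w \<in> phi_Ne ` unit_disc" by auto
qed

text \<open>The imaginary part of \<open>phi_Ne (x + i y)\<close> is \<open>y (1 - x\<^sup>2 + y\<^sup>2 / 3)\<close>, so inside the unit disc
  \<open>phi_Ne\<close> takes real values only on the real axis. There
  \<open>2/3 - (x - x\<^sup>3 / 3) = (1 - x)\<^sup>2 (x + 2) / 3\<close> is positive.\<close>

lemma notin_phi_Ne_image:
  fixes r :: real
  assumes "2 / 3 \<le> r"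
  shows "1 + of_real r \<notin> phi_Ne ` unit_disc"
proof
  assume "1 + of_real r \<in> phi_Ne ` unit_disc"
  then obtain z :: complex where z: "norm z < 1" and eq: "z - z ^ 3 / 3 = of_real r"
    by (auto simp: phi_Ne_def algebra_simps)
  define x y where "x = Re z" and "y = Im z"
  have "\<bar>x\<bar> < 1" using z abs_Re_le_cmod[of z] by (simp add: x_def)
  then have x2: "x\<^sup>2 < 1" by (simp add: abs_square_less_1)
  have "Im (z - z ^ 3 / 3) = y * (1 - x\<^sup>2 + y\<^sup>2 / 3)"
    by (simp add: x_def y_def power2_eq_square power3_eq_cube field_simps)
  then have "y * (1 - x\<^sup>2 + y\<^sup>2 / 3) = 0" by (simp add: eq)
  moreover have "1 - x\<^sup>2 + y\<^sup>2 / 3 > 0"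
    using x2 zero_le_power2[of y] by linarith
  ultimately have "y = 0" by auto
  have "r = Re (z - z ^ 3 / 3)" by (simp add: eq)
  also have "\<dots> = x - x ^ 3 / 3"
    using \<open>y = 0\<close> by (simp add: x_def y_def power3_eq_cube)
  also have "\<dots> = 2 / 3 - (1 - x)\<^sup>2 * (x + 2) / 3"
    by (simp add: power2_eq_square power3_eq_cube field_simps)
  also have "\<dots> < 2 / 3"
    using \<open>\<bar>x\<bar> < 1\<close> by (auto intro!: mult_pos_pos)
  finally show False using assms by simp
qed

lemma subordinate_add_one_iff:
  "f \<prec>\<^sub>s (\<lambda>z. 1 + z) \<longleftrightarrow> f 0 = 1 \<and> (\<forall>z \<in> unit_disc. norm (f z - 1) < 1)"
proof -
  have "(\<lambda>z. 1 + z) ` unit_disc = ball (1 :: complex) 1"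
    using image_add_ball[of 1 "0 :: complex" 1] by simp
  then show ?thesis
    by (auto simp: subordinate_def dist_norm norm_minus_commute image_subset_iff)
qed

theorem theorem3p2:
  shows "(\<forall>(\<beta>::real) p. \<beta> \<ge> 1 / 2 \<longrightarrow> p holomorphic_on unit_disc \<longrightarrow> p 0 = 1 \<longrightarrow>
            (\<lambda>z. p z + of_real \<beta> * z * deriv p z) \<prec>\<^sub>s (\<lambda>z. 1 + z) \<longrightarrow> p \<prec>\<^sub>s phi_Ne)
       \<and> (\<forall>\<beta>::real. 0 < \<beta> \<and> \<beta> < 1 / 2 \<longrightarrow>
            (\<exists>p. p holomorphic_on unit_disc \<and> p 0 = 1 \<and>
              (\<lambda>z. p z + of_real \<beta> * z * deriv p z) \<prec>\<^sub>s (\<lambda>z. 1 + z) \<and> \<not> p \<prec>\<^sub>s phi_Ne))"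
proof (intro conjI allI impI)
  fix \<beta> :: real and p :: "complex \<Rightarrow> complex"
  assume \<beta>: "\<beta> \<ge> 1 / 2" and hol: "p holomorphic_on unit_disc" and p0: "p 0 = 1"
    and sub: "(\<lambda>z. p z + of_real \<beta> * z * deriv p z) \<prec>\<^sub>s (\<lambda>z. 1 + z)"
  define P where "P z = p z - 1" for z
  define Q where "Q z = P z + of_real \<beta> * z * deriv P z" for z
  have holP: "P holomorphic_on unit_disc"
    unfolding P_def by (intro holomorphic_intros hol)
  have derivP: "deriv P z = deriv p z" if "z \<in> unit_disc" for z
    unfolding P_def
    using holomorphic_on_imp_differentiable_at[OF hol open_ball that] by (simp add: deriv_diff)
  have "Q holomorphic_on unit_disc"
    unfolding Q_def by (intro holomorphic_intros holP) auto
  moreover have "Q 0 = 0"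
    by (simp add: Q_def P_def p0)
  moreover have "norm (Q z) < 1" if "norm z < 1" for z
    using sub that derivP[of z]
    by (auto simp: subordinate_add_one_iff Q_def P_def diff_add_eq)
  ultimately have "norm (Q z) \<le> norm z" if "z \<in> unit_disc" for z
    using Schwarz_Lemma(1)[of Q z] that by auto
  then have P: "norm (P z) \<le> norm z / (1 + \<beta>)" if "z \<in> unit_disc" for z
    using norm_le_if_norm_add_deriv_le[OF _ holP _ that, of \<beta>] \<beta> by (simp add: Q_def)
  have "p z \<in> ball 1 (2 / 3)" if "z \<in> unit_disc" for z
  proof -
    have "norm (P z) \<le> norm z / (1 + \<beta>)" by (rule P[OF that])
    also have "\<dots> < 2 / 3" using that \<beta> by (simp add: field_simps)
    finally show ?thesis by (simp add: P_def dist_norm norm_minus_commute)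
  qed
  then show "p \<prec>\<^sub>s phi_Ne"
    using ball_subset_phi_Ne_image p0 by (auto simp: subordinate_def phi_Ne_def)
next
  fix \<beta> :: real
  assume "0 < \<beta> \<and> \<beta> < 1 / 2"
  then have \<beta>: "0 < \<beta>" "\<beta> < 1 / 2" by auto
  define p :: "complex \<Rightarrow> complex" where "p z = 1 + z / of_real (1 + \<beta>)" for z
  have nz: "of_real (1 + \<beta>) \<noteq> (0 :: complex)"
    using \<beta> by (subst of_real_eq_0_iff) simp
  have "deriv p z = 1 / of_real (1 + \<beta>)" for z
    unfolding p_def using nz by (intro DERIV_imp_deriv) (auto intro!: derivative_eq_intros)
  then have "p z + of_real \<beta> * z * deriv p z = 1 + z" for z
    using nz by (simp add: p_def divide_simps) (simp add: algebra_simps)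
  then have sub: "(\<lambda>z. p z + of_real \<beta> * z * deriv p z) \<prec>\<^sub>s (\<lambda>z. 1 + z)"
    by (simp add: subordinate_def)
  \<comment> \<open>At this point \<open>p\<close> takes exactly the value \<open>phi_Ne 1\<close> of the cusp.\<close>
  define z where "z = complex_of_real (2 / 3 * (1 + \<beta>))"
  have "norm z = 2 / 3 * (1 + \<beta>)"
    unfolding z_def norm_of_real using \<beta> by simp
  then have "z \<in> unit_disc" using \<beta> by simp
  moreover have "p z = 1 + of_real (2 / 3)"
    unfolding p_def z_def of_real_mult by (simp only: nonzero_mult_div_cancel_right[OF nz])
  ultimately have "\<not> p \<prec>\<^sub>s phi_Ne"
    using notin_phi_Ne_image[of "2 / 3"] by (fastforce simp: subordinate_def)
  moreover have "p holomorphic_on unit_disc"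
    unfolding p_def using nz by (intro holomorphic_intros) auto
  moreover have "p 0 = 1" by (simp add: p_def)
  ultimately show "\<exists>p. p holomorphic_on unit_disc \<and> p 0 = 1 \<and>
      (\<lambda>z. p z + of_real \<beta> * z * deriv p z) \<prec>\<^sub>s (\<lambda>z. 1 + z) \<and> \<not> p \<prec>\<^sub>s phi_Ne"
    using sub by blast
qed

end
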